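(* For the OWNM problem with revoking and arbitrary positive weights, the algorithm Big-Improvement-Match (\textsc{Bim}) with parameter $r\in(1,\sqrt2]$ has strict competitive ratio at least $\min\left\{\frac{r^2-1}{r^3},\ \frac{1}{1+2r}\right\}$, i.e., $\textsc{Bim}(I)\ge \min\left\{\frac{r^2-1}{r^3},\frac{1}{1+2r}\right\}\textsc{OPT}(I)$ for every input $I$.
   Context: OWNM with revoking: points $p_1,\dots,p_{2n}$ in general position in the plane arrive online with weights $w(p_i)>0$. Upon arrival of a point, an algorithm may first irrevocably remove one edge from its current matching, and then leave the new point unmatched or match it with a currently unmatched earlier point, keeping the segments of matched pairs pairwise non-crossing. The profit is the total weight of points matched in the final matching; $\textsc{OPT}(I)=\sum_i w(p_i)$. Algorithm \textsc{Bim} (parameter $r>1$): it maintains a partition of the plane into regions, each assigned an edge of the current matching responsible for it. It matches $p_1$ and $p_2$ regardless of weights; the line $\overline{p_1p_2}$ divides the plane into two half-planes, and $\overline{p_1p_2}$ is responsible for both. For $i\ge3$, let $p_i$ arrive in region $R$ with responsible edge $\overline{p_jp_{j'}}$, where $w(p_j)\le w(p_{j'})$. If $R$ contains at least one unmatched point, $p_i$ is matched with an unmatched point $p_k$ of $R$ of highest weight; $\overline{p_jp_{j'}}$ is no longer responsible for $R$, $R$ is divided by the line $\overline{p_ip_k}$ into two regions, and $\overline{p_ip_k}$ becomes responsible for both. Otherwise ($p_i$ is the only point in $R$): if $w(p_i)<r\,w(p_{j'})$, $p_i$ is left unmatched; else the match $(p_j,p_{j'})$ is removed and $p_i$ is matched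 with $p_{j'}$. In the latter case, if $R$ was the only region $\overline{p_jp_{j'}}$ was responsible for, $R$ is divided by the line $\overline{p_ip_{j'}}$ into two regions and $\overline{p_ip_{j'}}$ becomes responsible for both (other regions keep their boundaries); if $\overline{p_jp_{j'}}$ was also responsible for a region $R'$, then $R$ and $R'$ are merged into $R\cup R'$, which is divided by the line $\overline{p_ip_{j'}}$ into two regions, and $\overline{p_ip_{j'}}$ becomes responsible for both. *)

theory Defs
  imports "HOL-Analysis.Analysis"
begin

type_synonym point = "real ^ 2"
type_synonym edge = "point set"  (* a two-element set: the matched pair *)
type_synonym region = "point set"

definition general_position :: "point list \<Rightarrow> bool" where
  "general_position ps \<longleftrightarrow> distinct ps \<and>
     (\<forall>a\<in>set ps. \<forall>b\<in>set ps. \<forall>c\<in>set ps.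
        a \<noteq> b \<and> b \<noteq> c \<and> a \<noteq> c \<longrightarrow> \<not> collinear {a, b, c})"

(* Twice the signed area of the triangle a b x: zero exactly on the line through a and b,
   positive on one open side of it and negative on the other. *)
definition orient :: "point \<Rightarrow> point \<Rightarrow> point \<Rightarrow> real" where
  "orient a b x = (b$1 - a$1) * (x$2 - a$2) - (b$2 - a$2) * (x$1 - a$1)"

(* Points on the dividing line itself are put into neither part. In general position no input
   point other than a and b lies on that line, and a and b are matched to each other when the
   line is drawn. *)
definition divide :: "region \<Rightarrow> point \<Rightarrow> point \<Rightarrow> region set" where
  "divide R a b = {{x \<in> R. orient a b x > 0}, {x \<in> R. orient a b x < 0}}"

(* State (M, U, D): M is the current matching, U the set of unmatched points that have arrived,
   and (R, e) \<in> D means that R is a region of the partition and e is responsible for R. *)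
type_synonym bim_state = "edge set \<times> point set \<times> (region \<times> edge) set"

(* The relation leaves all ties open: every unmatched point of highest weight may be chosen as q,
   and if w a = w b then either endpoint of the revoked edge may play the role of the lighter one.

   In improve, the union collects the one or two regions of the revoked edge {a, b}. The freed
   point a lies on the line through a and b, hence on the boundary of that union or on the line
   along which it was cut, and so in no region so far. It is counted as a point of the region
   that is divided next, and of no other region. *)
inductive bim_step :: "real \<Rightarrow> (point \<Rightarrow> real) \<Rightarrow> point \<Rightarrow> bim_state \<Rightarrow> bim_state \<Rightarrow> bool"
  for r :: real and w :: "point \<Rightarrow> real" and p :: point where
  match:
    "\<lbrakk>(R, e) \<in> D; p \<in> R; q \<in> U \<inter> R; \<forall>u\<in>U \<inter> R. w u \<le> w q\<rbrakk> \<Longrightarrow>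
     bim_step r w p (M, U, D)
       (insert {p, q} M, U - {q}, (D - {(R, e)}) \<union> divide R p q \<times> {{p, q}})"
| skip:
    "\<lbrakk>(R, {a, b}) \<in> D; p \<in> R; U \<inter> R = {}; w a \<le> w b; w p < r * w b\<rbrakk> \<Longrightarrow>
     bim_step r w p (M, U, D) (M, insert p U, D)"
| improve:
    "\<lbrakk>(R, {a, b}) \<in> D; p \<in> R; U \<inter> R = {}; w a \<le> w b; w p \<ge> r * w b\<rbrakk> \<Longrightarrow>
     bim_step r w p (M, U, D)
       (insert {p, b} (M - {{a, b}}), insert a U,
        {(S, f) \<in> D. f \<noteq> {a, b}} \<union>
          divide (insert a (\<Union>{S. (S, {a, b}) \<in> D})) p b \<times> {{p, b}})"

inductive bim_run :: "real \<Rightarrow> (point \<Rightarrow> real) \<Rightarrow> point list \<Rightarrow> bim_state \<Rightarrow> bool"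
  for r :: real and w :: "point \<Rightarrow> real" where
  start: "bim_run r w [p\<^sub>1, p\<^sub>2]
            ({{p\<^sub>1, p\<^sub>2}}, {}, divide UNIV p\<^sub>1 p\<^sub>2 \<times> {{p\<^sub>1, p\<^sub>2}})"
| arrive: "\<lbrakk>bim_run r w ps S; bim_step r w p S S'\<rbrakk> \<Longrightarrow> bim_run r w (ps @ [p]) S'"

definition bim_result :: "real \<Rightarrow> (point \<Rightarrow> real) \<Rightarrow> point list \<Rightarrow> edge set \<Rightarrow> bool" where
  "bim_result r w ps M \<longleftrightarrow> (\<exists>U D. bim_run r w ps (M, U, D))"

definition profit :: "(point \<Rightarrow> real) \<Rightarrow> edge set \<Rightarrow> real" where
  "profit w M = (\<Sum>p\<in>\<Union>M. w p)"

(* An even number of points in general position always has a perfect non-crossing matching, so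
   the offline optimum is the total weight. *)
definition OPT :: "(point \<Rightarrow> real) \<Rightarrow> point list \<Rightarrow> real" where
  "OPT w ps = (\<Sum>p\<leftarrow>ps. w p)"

lemma orient_eq_0_imp_collinear:
  assumes "orient a b c = 0" "a \<noteq> b"
  shows "collinear {a, b, c}"
proof -
  have eq: "(b$1 - a$1) * (c$2 - a$2) = (b$2 - a$2) * (c$1 - a$1)"
    using assms(1) by (simp add: orient_def)
  have "\<exists>u. c = u *\<^sub>R a + (1 - u) *\<^sub>R b"
  proof (cases "b$1 = a$1")
    case True
    with assms(2) have ne: "b$2 - a$2 \<noteq> 0" by (auto simp: vec_eq_iff forall_2)
    with eq True have c1: "c$1 = a$1" by simp
    define t where "t = (c$2 - a$2) / (b$2 - a$2)"
    have "t * (b$2 - a$2) = c$2 - a$2" using ne by (simp add: t_def)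
    then have "c = (1 - t) *\<^sub>R a + (1 - (1 - t)) *\<^sub>R b"
      using True c1 by (simp add: vec_eq_iff forall_2 algebra_simps)
    then show ?thesis by blast
  next
    case False
    define t where "t = (c$1 - a$1) / (b$1 - a$1)"
    have t1: "t * (b$1 - a$1) = c$1 - a$1" using False by (simp add: t_def)
    have "(b$1 - a$1) * (t * (b$2 - a$2)) = (b$1 - a$1) * (c$2 - a$2)"
      unfolding eq t1[symmetric] by (simp only: mult_ac)
    then have t2: "t * (b$2 - a$2) = c$2 - a$2" using False by simp
    have "c = (1 - t) *\<^sub>R a + (1 - (1 - t)) *\<^sub>R b"
      using t1 t2 by (simp add: vec_eq_iff forall_2 algebra_simps)
    then show ?thesis by blast
  qed
  then have "collinear {a, c, b}" by (auto simp: collinear_3_expand)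
  then show ?thesis by (simp add: insert_commute)
qed

lemma divide_covers:
  assumes "x \<in> R" "a \<noteq> b" "\<not> collinear {a, b, x}"
  shows "\<exists>S\<in>divide R a b. x \<in> S"
proof -
  have "orient a b x \<noteq> 0" using orient_eq_0_imp_collinear assms by blast
  then have "orient a b x > 0 \<or> orient a b x < 0" by linarith
  then show ?thesis using assms(1) by (auto simp: divide_def)
qed

definition bim_ok :: "point list \<Rightarrow> bim_state \<Rightarrow> bool" where
  "bim_ok ps S \<longleftrightarrow>
     fst (snd S) \<subseteq> set ps \<and>
     (\<forall>R e. (R, e) \<in> snd (snd S) \<longrightarrow> (\<exists>a\<in>set ps. \<exists>b\<in>set ps. a \<noteq> b \<and> e = {a, b})) \<and>
     (\<forall>x. (\<forall>a\<in>set ps. \<forall>b\<in>set ps. a \<noteq> b \<longrightarrow> \<not> collinear {a, b, x})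
        \<longrightarrow> (\<exists>R e. (R, e) \<in> snd (snd S) \<and> x \<in> R))"

lemma bim_okI:
  assumes "U \<subseteq> set ps"
    and "\<And>R e. (R, e) \<in> D \<Longrightarrow> \<exists>a\<in>set ps. \<exists>b\<in>set ps. a \<noteq> b \<and> e = {a, b}"
    and "\<And>x. \<forall>a\<in>set ps. \<forall>b\<in>set ps. a \<noteq> b \<longrightarrow> \<not> collinear {a, b, x} \<Longrightarrow>
           \<exists>R e. (R, e) \<in> D \<and> x \<in> R"
  shows "bim_ok ps (M, U, D)"
  using assms unfolding bim_ok_def fst_conv snd_conv by blast

lemma bim_ok_step:
  assumes ok: "bim_ok ps S" and np: "p \<notin> set ps"
    and gp: "\<forall>a\<in>set ps. \<forall>b\<in>set ps. a \<noteq> b \<longrightarrow> \<not> collinear {a, b, p}"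
  shows "\<exists>S'. bim_step r w p S S' \<and> bim_ok (ps @ [p]) S'"
proof -
  obtain M U D where S: "S = (M, U, D)" by (cases S)
  have U: "U \<subseteq> set ps"
    and E: "\<And>R e. (R, e) \<in> D \<Longrightarrow> \<exists>a\<in>set ps. \<exists>b\<in>set ps. a \<noteq> b \<and> e = {a, b}"
    and C: "\<And>x. \<forall>a\<in>set ps. \<forall>b\<in>set ps. a \<noteq> b \<longrightarrow> \<not> collinear {a, b, x}
              \<Longrightarrow> \<exists>R e. (R, e) \<in> D \<and> x \<in> R"
    using ok unfolding bim_ok_def S fst_conv snd_conv by blast+
  obtain R e where R: "(R, e) \<in> D" "p \<in> R" using C gp by blast
  show ?thesis
  proof (cases "U \<inter> R = {}")
    case False
    have fin: "finite (U \<inter> R)" using U finite_subset by blast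
    have "Max (w ` (U \<inter> R)) \<in> w ` (U \<inter> R)" using fin False by (intro Max_in) auto
    then obtain q where q: "q \<in> U \<inter> R" "w q = Max (w ` (U \<inter> R))" by auto
    have qm: "\<forall>u\<in>U \<inter> R. w u \<le> w q" using fin q by auto
    let ?D = "(D - {(R, e)}) \<union> divide R p q \<times> {{p, q}}"
    have qs: "q \<in> set ps" "p \<noteq> q" using q U np by auto
    have "bim_ok (ps @ [p]) (insert {p, q} M, U - {q}, ?D)"
    proof -
      have 2: "\<exists>a\<in>set (ps @ [p]). \<exists>b\<in>set (ps @ [p]). a \<noteq> b \<and> f = {a, b}"
        if "(T, f) \<in> ?D" for T f
      proof (cases "(T, f) \<in> D")
        case True
        from E[OF True] show ?thesis by auto
      next
        case False
        with that have "f = {p, q}" by blast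
        with qs show ?thesis by auto
      qed
      have 3: "\<exists>T f. (T, f) \<in> ?D \<and> x \<in> T"
        if x: "\<forall>a\<in>set (ps @ [p]). \<forall>b\<in>set (ps @ [p]). a \<noteq> b \<longrightarrow> \<not> collinear {a, b, x}" for x
      proof -
        have "\<exists>T f. (T, f) \<in> D \<and> x \<in> T" using x by (intro C) simp
        then obtain T f where T: "(T, f) \<in> D" "x \<in> T" by blast
        show ?thesis
        proof (cases "(T, f) = (R, e)")
          case True
          then have "\<exists>V\<in>divide R p q. x \<in> V" using T x qs by (intro divide_covers) auto
          then show ?thesis by blast
        qed (use T in blast)
      qed
      show ?thesis using U by (intro bim_okI 2 3) auto
    qed
    then show ?thesis using bim_step.match[OF R q(1) qm, of r M] S by blast
  next
    case True
    obtain a b where ab: "a \<in> set ps" "b \<in> set ps" "a \<noteq> b" "e = {a, b}" "w a \<le> w b"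
    proof -
      from E[OF R(1)] obtain a b where *: "a \<in> set ps" "b \<in> set ps" "a \<noteq> b" "e = {a, b}" by blast
      show thesis
      proof (cases "w a \<le> w b")
        case True
        then show ?thesis using that * by blast
      next
        case False
        then show ?thesis using that[of b a] * by (auto simp: insert_commute)
      qed
    qed
    have R': "(R, {a, b}) \<in> D" using R ab by simp
    show ?thesis
    proof (cases "w p < r * w b")
      case less: True
      have 2: "\<exists>c\<in>set (ps @ [p]). \<exists>d\<in>set (ps @ [p]). c \<noteq> d \<and> f = {c, d}"
        if "(T, f) \<in> D" for T f
        using E[OF that] by auto
      have 3: "\<exists>T f. (T, f) \<in> D \<and> x \<in> T"
        if "\<forall>a\<in>set (ps @ [p]). \<forall>b\<in>set (ps @ [p]). a \<noteq> b \<longrightarrow> \<not> collinear {a, b, x}" for x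
        using C[of x] that by simp
      have "bim_ok (ps @ [p]) (M, insert p U, D)"
        using U by (intro bim_okI 2 3) auto
      then show ?thesis using bim_step.skip[OF R' R(2) True ab(5) less, of M] S by blast
    next
      case False
      then have ge: "w p \<ge> r * w b" by simp
      let ?R = "insert a (\<Union>{S. (S, {a, b}) \<in> D})"
      let ?D = "{(S, f) \<in> D. f \<noteq> {a, b}} \<union> divide ?R p b \<times> {{p, b}}"
      have pb: "p \<noteq> b" using ab np by auto
      have 2: "\<exists>c\<in>set (ps @ [p]). \<exists>d\<in>set (ps @ [p]). c \<noteq> d \<and> f = {c, d}"
        if "(T, f) \<in> ?D" for T f
      proof (cases "(T, f) \<in> D")
        case True
        from E[OF True] show ?thesis by auto
      next
        case False
        with that have "f = {p, b}" by blast
        with ab pb show ?thesis by auto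
      qed
      have 3: "\<exists>T f. (T, f) \<in> ?D \<and> x \<in> T"
        if x: "\<forall>a\<in>set (ps @ [p]). \<forall>b\<in>set (ps @ [p]). a \<noteq> b \<longrightarrow> \<not> collinear {a, b, x}" for x
      proof -
        have "\<exists>T f. (T, f) \<in> D \<and> x \<in> T" using x by (intro C) simp
        then obtain T f where T: "(T, f) \<in> D" "x \<in> T" by blast
        show ?thesis
        proof (cases "f = {a, b}")
          case True
          then have "x \<in> ?R" using T by blast
          then have "\<exists>V\<in>divide ?R p b. x \<in> V" using x ab pb by (intro divide_covers) auto
          then show ?thesis by blast
        qed (use T in blast)
      qed
      have "bim_ok (ps @ [p]) (insert {p, b} (M - {{a, b}}), insert a U, ?D)"
        using U ab by (intro bim_okI 2 3) auto
      then show ?thesis using bim_step.improve[OF R' R(2) True ab(5) ge, of M] S by blast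
    qed
  qed
qed

lemma bim_run_exists:
  assumes "general_position ps" "length ps \<ge> 2"
  shows "\<exists>S. bim_run r w ps S \<and> bim_ok ps S"
  using assms
proof (induction ps rule: rev_induct)
  case Nil
  then show ?case by simp
next
  case (snoc p ps)
  show ?case
  proof (cases "length ps \<ge> 2")
    case True
    have "general_position ps" using snoc.prems(1) by (auto simp: general_position_def)
    with snoc.IH True obtain S where S: "bim_run r w ps S" "bim_ok ps S" by blast
    have np: "p \<notin> set ps" using snoc.prems(1) by (simp add: general_position_def)
    have "\<forall>a\<in>set ps. \<forall>b\<in>set ps. a \<noteq> b \<longrightarrow> \<not> collinear {a, b, p}"
      using snoc.prems(1) np unfolding general_position_def by auto
    with bim_ok_step[OF S(2) np] S(1) show ?thesis by (meson bim_run.arrive)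
  next
    case False
    then have "length ps = 1" using snoc.prems(2) by simp
    then obtain p1 where ps: "ps = [p1]" by (cases ps) auto
    have ne: "p1 \<noteq> p" using snoc.prems(1) ps by (auto simp: general_position_def)
    let ?D = "divide UNIV p1 p \<times> {{p1, p}}"
    have "\<exists>T f. (T, f) \<in> ?D \<and> x \<in> T" if "\<not> collinear {p1, p, x}" for x
      using divide_covers[of x UNIV p1 p] that ne by blast
    then have "bim_ok (ps @ [p]) ({{p1, p}}, {}, ?D)"
      using ne ps by (intro bim_okI) auto
    then show ?thesis using bim_run.start[of r w p1 p] ps by auto
  qed
qed

(* The relational description never gets stuck: every admissible input has an outcome. *)
theorem bim_result_exists:
  assumes "general_position ps" "length ps \<ge> 2"
  shows "\<exists>M. bim_result r w ps M"
  using bim_run_exists[OF assms] unfolding bim_result_def by (metis prod_cases3)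

end

theory Submission
  imports Defs
begin

text \<open>
  Let \<open>c\<close> be the claimed ratio. Every edge \<open>{x, y}\<close> of the matching, \<open>w x \<le> w y\<close>, holds an account,
  and the accounts sum up to \<open>profit - c * OPT\<close>. A new match \<open>{p, q}\<close> opens an account with
  \<open>(1 - c) * w p + w q\<close> (the point \<open>q\<close> was charged on its arrival), a skipped point \<open>p\<close> costs the
  responsible edge \<open>c * w p\<close>, and an improvement passes the account on to the new edge with
  \<open>(1 - c) * w p - w a\<close> added. A point is skipped only in a region without unmatched points; an
  edge has at most two of these before its first improvement and at most one afterwards, since the
  freed point occupies the other one. So the accounts stay nonnegative. The bound \<open>1 / (1 + 2 * r)\<close>
  comes from two skipped points at an edge that never improves, \<open>(r\<^sup>2 - 1) / r ^ 3\<close> from an infinite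
  chain of improvements, and \<open>r \<le> sqrt 2\<close> is what the first improvement needs.
\<close>

text \<open>
  The balance \<open>A\<close> of an edge with weights \<open>x \<le> y\<close> and \<open>m\<close> regions in which a point may still be
  skipped: the first alternative is for an edge that comes from a match, the second for one that
  comes from an improvement. There the coefficient of \<open>y\<close> is what remains of \<open>1 - c\<close> when a later
  skip is reserved, and that of \<open>x\<close> is the largest one that the next improvement preserves at
  \<open>y = r * x\<close>; at this \<open>y\<close> and \<open>m = 0\<close> the bound is nonnegative iff \<open>c \<le> (r\<^sup>2 - 1) / r ^ 3\<close>.
\<close>

definition secured :: "real \<Rightarrow> real \<Rightarrow> real \<Rightarrow> real \<Rightarrow> nat \<Rightarrow> real \<Rightarrow> bool" where
  "secured r c x y m A \<longleftrightarrow>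
     (1 - c) * (x + y) - (2 - real m) * (c * r * y) \<le> A \<or>
     m \<le> 1 \<and> r * x \<le> y \<and>
       (1 - c * r / (r - 1)) * x + (1 - c - c * r) * y + real m * (c * r * y) \<le> A"

section \<open>Arithmetic of a single account\<close>

lemma secured_mono:
  assumes "secured r c x y m A" "m' \<le> m" "0 \<le> c" "0 \<le> r" "0 \<le> y"
  shows "secured r c x y m' A"
proof -
  have "real m' * (c * r * y) \<le> real m * (c * r * y)"
    using assms by (intro mult_right_mono) auto
  with assms(1,2) show ?thesis
    unfolding secured_def left_diff_distrib by linarith
qed

lemma secured_fresh:
  assumes "(1 - c) * (x + y) \<le> A" "m \<le> 2" "0 \<le> c" "0 \<le> r" "0 \<le> y"
  shows "secured r c x y m A"
proof -
  have "0 \<le> (2 - real m) * (c * r * y)" using assms by (intro mult_nonneg_nonneg) auto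
  with assms(1) show ?thesis unfolding secured_def by linarith
qed

text \<open>In both alternatives the bound drops by \<open>c * r * y\<close> per lost region, and a
  skipped point, having weight at most \<open>r * y\<close>, is charged no more than that.\<close>

lemma secured_skip:
  assumes "secured r c x y m A" "m' < m" "0 \<le> c" "0 \<le> r" "0 \<le> y" "p \<le> r * y"
  shows "secured r c x y m' (A - c * p)"
proof -
  have 1: "c * p \<le> c * r * y" using mult_left_mono[OF assms(6,3)] by (simp add: mult.assoc)
  have "(real m' + 1) * (c * r * y) \<le> real m * (c * r * y)"
    using assms by (intro mult_right_mono) auto
  then have 2: "real m' * (c * r * y) + c * r * y \<le> real m * (c * r * y)"
    by (simp add: distrib_right)
  show ?thesis
    using assms(1,2) 1 2 unfolding secured_def left_diff_distrib by linarith
qed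

text \<open>At \<open>m = 0\<close>, the worst case, the first alternative is nonnegative because
  \<open>c * (1 + 2 * r) \<le> 1\<close>. In the second the coefficient of \<open>y\<close> is
  nonnegative, so \<open>y\<close> may be lowered to \<open>r * x\<close>; the coefficient of
  \<open>x\<close> then becomes \<open>((r\<^sup>2 - 1) - c * r ^ 3) / (r - 1)\<close>.\<close>

lemma secured_nonneg:
  assumes "secured r c x y m A" "1 < r" "0 \<le> c" "c * (1 + 2 * r) \<le> 1"
    and "c * r ^ 3 \<le> r\<^sup>2 - 1" "0 \<le> x" "0 \<le> y"
  shows "0 \<le> A"
proof -
  have cr: "c + 2 * (c * r) \<le> 1" using assms(4) by (simp add: algebra_simps)
  have cr0: "0 \<le> c * r" using assms by simp
  have cry: "0 \<le> c * r * y" using assms by simp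
  have le: "0 \<le> (1 - c) * (x + y) - 2 * (c * r * y)"
  proof -
    have "0 \<le> (1 - c) * x + (1 - c - 2 * (c * r)) * y"
      using cr cr0 assms(6,7) by (intro add_nonneg_nonneg mult_nonneg_nonneg) linarith+
    then show ?thesis by (simp add: algebra_simps)
  qed
  have "0 \<le> (1 - c * r / (r - 1)) * x + (1 - c - c * r) * y" if "r * x \<le> y"
  proof -
    have "0 \<le> ((r\<^sup>2 - 1) - c * r ^ 3) / (r - 1) * x"
      using assms by (intro mult_nonneg_nonneg divide_nonneg_nonneg) auto
    also have "\<dots> = (1 - c * r / (r - 1)) * x + (1 - c - c * r) * (r * x)"
      using assms(2) by (simp add: field_simps power2_eq_square power3_eq_cube)
    also have "\<dots> \<le> (1 - c * r / (r - 1)) * x + (1 - c - c * r) * y"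
      using that cr cr0 by (intro add_left_mono mult_left_mono) linarith+
    finally show ?thesis .
  qed
  moreover have "0 \<le> real m * (c * r * y)" using cry by simp
  ultimately show ?thesis
    using assms(1) le unfolding secured_def left_diff_distrib by linarith
qed

text \<open>The hypothesis \<open>1 \<le> m\<close> reflects that the improvement happens in a
  vacant region, \<open>m' \<le> 1\<close> that the freed point occupies one of the two new regions.
  The result always satisfies the second alternative.\<close>

lemma secured_improve:
  assumes "secured r c x y m A" "1 < r" "r \<le> sqrt 2" "0 \<le> c" 
    and "1 \<le> m" "m' \<le> 1" "0 \<le> x" "x \<le> y" "r * y \<le> z"
  shows "secured r c y z m' (A + (1 - c) * z - x)"
proof -
  let ?\<alpha> = "1 - c * r / (r - 1)" and ?\<beta> = "1 - c - c * r"
  have z: "0 \<le> z" using assms by (smt (verit) mult_nonneg_nonneg)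
  have y: "0 \<le> y" using assms by linarith
  have m': "real m' * (c * r * z) \<le> 1 * (c * r * z)"
    using assms z by (intro mult_right_mono) auto
  \<comment> \<open>This is the case \<open>m' = 1\<close>, the most demanding one. Here
    \<open>z\<close> has coefficient \<open>1 - c\<close> on both sides and cancels, so only
    \<open>x\<close>, \<open>y\<close> and \<open>A\<close> remain to be compared.\<close>
  have "?\<alpha> * y + ?\<beta> * z + c * r * z \<le> A + (1 - c) * z - x"
    using assms(1) unfolding secured_def
  proof (elim disjE conjE)
    assume A: "(1 - c) * (x + y) - (2 - real m) * (c * r * y) \<le> A"
    have "(2 - real m) * (c * r * y) \<le> 1 * (c * r * y)"
      using assms y by (intro mult_right_mono) auto
    with A have A': "(1 - c) * (x + y) - c * r * y \<le> A" by simp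
    have "r\<^sup>2 \<le> 2" using power_mono[OF assms(3), of 2] assms(2) by simp
    \<comment> \<open>With \<open>x\<close> raised to \<open>y\<close>, the first alternative needs
      \<open>(2 + r) * (r - 1) \<le> r\<close>, which is \<open>r\<^sup>2 \<le> 2\<close>.\<close>
    then have "2 + r \<le> r / (r - 1)"
      using assms(2) by (simp add: field_simps power2_eq_square)
    then have "c * (2 + r) \<le> c * (r / (r - 1))" using assms(4) by (rule mult_left_mono)
    then have "c * (2 + r) * y \<le> c * r / (r - 1) * y" using y by (intro mult_right_mono) auto
    moreover have "c * x \<le> c * y" using assms by (intro mult_left_mono) auto
    ultimately show ?thesis using A' by (simp add: algebra_simps)
  next
    assume "m \<le> 1" and rx: "r * x \<le> y"
      and A: "?\<alpha> * x + ?\<beta> * y + real m * (c * r * y) \<le> A"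
    then have m: "real m = 1" using assms by simp
    \<comment> \<open>After cancellation the claim is
      \<open>c * r / (r - 1) * x \<le> c / (r - 1) * y\<close>, exactly what
      \<open>r * x \<le> y\<close> gives.\<close>
    have "c / (r - 1) * (r * x) \<le> c / (r - 1) * y"
      using rx assms by (intro mult_left_mono) auto
    moreover have "c * r / (r - 1) * y = c * y + c / (r - 1) * y"
      using assms(2) by (simp add: field_simps)
    ultimately show ?thesis using A unfolding m by (simp add: algebra_simps)
  qed
  with m' show ?thesis unfolding secured_def using assms(6,9) by linarith
qed


lemma secured_match:
  assumes "0 \<le> c" "0 \<le> r" "m \<le> 2" "0 \<le> w p" "0 \<le> w q"
  shows "secured r c (Min (w ` {p, q})) (Max (w ` {p, q})) m ((1 - c) * w p + w q)"
proof (rule secured_fresh)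
  have "Min (w ` {p, q}) + Max (w ` {p, q}) = w p + w q" by (simp add: min_def max_def)
  moreover have "0 \<le> c * w q" using assms by simp
  ultimately show "(1 - c) * (Min (w ` {p, q}) + Max (w ` {p, q})) \<le> (1 - c) * w p + w q"
    by (simp add: algebra_simps)
qed (use assms in auto)

section \<open>Vacant regions and the shape of reachable states\<close>

text \<open>Only in these regions can a point be skipped at the expense of \<open>e\<close>; their
  number is the \<open>m\<close> of \<open>secured\<close>.\<close>

definition vacant :: "bim_state \<Rightarrow> edge \<Rightarrow> region set" where
  "vacant S e = {R. (R, e) \<in> snd (snd S) \<and> fst (snd S) \<inter> R = {}}"

text \<open>Disjointness of regions is phrased through a common point, so an empty region may be
  listed for several edges. That regions avoid matched points ensures that a freed endpoint lies in
  no old region.\<close>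

definition bim_wf :: "point list \<Rightarrow> bim_state \<Rightarrow> bool" where
  "bim_wf ps S \<longleftrightarrow> (case S of (M, U, D) \<Rightarrow>
     \<Union>M \<subseteq> set ps \<and> U \<subseteq> set ps \<and> \<Union>M \<inter> U = {} \<and> disjoint M \<and>
     (\<forall>e. e \<in> M \<longrightarrow> card e = 2) \<and> finite D \<and>
     (\<forall>R e. (R, e) \<in> D \<longrightarrow> e \<in> M) \<and> (\<forall>R e. (R, e) \<in> D \<longrightarrow> R \<inter> \<Union>M = {}) \<and>
     (\<forall>R e R' e' x. (R, e) \<in> D \<longrightarrow> (R', e') \<in> D \<longrightarrow> x \<in> R \<longrightarrow> x \<in> R' \<longrightarrow> R = R' \<and> e = e'))"

lemma bim_wfI:
  assumes "\<Union>M \<subseteq> set ps" "U \<subseteq> set ps" "\<Union>M \<inter> U = {}" "disjoint M"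
    and "\<And>e. e \<in> M \<Longrightarrow> card e = 2" "finite D"
    and "\<And>R e. (R, e) \<in> D \<Longrightarrow> e \<in> M" "\<And>R e. (R, e) \<in> D \<Longrightarrow> R \<inter> \<Union>M = {}"
    and "\<And>R e R' e' x. (R, e) \<in> D \<Longrightarrow> (R', e') \<in> D \<Longrightarrow> x \<in> R \<Longrightarrow> x \<in> R' \<Longrightarrow> R = R' \<and> e = e'"
  shows "bim_wf ps (M, U, D)"
proof -
  have "\<forall>R e R' e' x. (R, e) \<in> D \<longrightarrow> (R', e') \<in> D \<longrightarrow> x \<in> R \<longrightarrow> x \<in> R' \<longrightarrow> R = R' \<and> e = e'"
    using assms(9) by blast
  with assms(1-8) show ?thesis unfolding bim_wf_def prod.case by blast
qed

lemma bim_wfD: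
  assumes "bim_wf ps (M, U, D)"
  shows "\<Union>M \<subseteq> set ps" "U \<subseteq> set ps" "\<Union>M \<inter> U = {}" "disjoint M"
    and "\<And>e. e \<in> M \<Longrightarrow> card e = 2" "finite D" "finite M"
    and "\<And>R e. (R, e) \<in> D \<Longrightarrow> e \<in> M" "\<And>R e. (R, e) \<in> D \<Longrightarrow> R \<inter> \<Union>M = {}"
    and "\<And>R e R' e' x. (R, e) \<in> D \<Longrightarrow> (R', e') \<in> D \<Longrightarrow> x \<in> R \<Longrightarrow> x \<in> R' \<Longrightarrow> R = R' \<and> e = e'"
proof -
  show M: "\<Union>M \<subseteq> set ps" using assms by (simp add: bim_wf_def)
  show "finite M" using finite_UnionD[OF finite_subset[OF M]] by simp
  have *: "\<forall>R e R' e' x. (R, e) \<in> D \<longrightarrow> (R', e') \<in> D \<longrightarrow> x \<in> R \<longrightarrow> x \<in> R' \<longrightarrow> R = R' \<and> e = e'"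
    using assms unfolding bim_wf_def prod.case by (elim conjE) assumption
  have "\<forall>R e. (R, e) \<in> D \<longrightarrow> R \<inter> \<Union>M = {}"
    using assms unfolding bim_wf_def prod.case by (elim conjE) assumption
  then show "R \<inter> \<Union>M = {}" if "(R, e) \<in> D" for R e using that by blast
  show "R = R' \<and> e = e'" if "(R, e) \<in> D" "(R', e') \<in> D" "x \<in> R" "x \<in> R'" for R e R' e' x
    using * that by metis
  show "e \<in> M" if "(R, e) \<in> D" for R e
  proof -
    have "\<forall>R e. (R, e) \<in> D \<longrightarrow> e \<in> M"
      using assms unfolding bim_wf_def prod.case by (elim conjE) assumption
    with that show ?thesis by blast
  qed
qed (use assms in \<open>simp_all add: bim_wf_def\<close>)

lemma divideD:
  assumes "S \<in> divide R a b"
  shows "S \<subseteq> R" "a \<notin> S" "b \<notin> S"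
  using assms by (auto simp: divide_def orient_def)

lemma divide_disjoint:
  assumes "S \<in> divide R a b" "S' \<in> divide R a b" "x \<in> S" "x \<in> S'"
  shows "S = S'"
  using assms by (auto simp: divide_def)

lemma finite_divide: "finite (divide R a b)" and card_divide: "card (divide R a b) \<le> 2"
  by (simp_all add: divide_def card_insert_if)

text \<open>The freed point \<open>a\<close> is off the dividing line, so it falls into one of the
  at most two parts and occupies it.\<close>

lemma vacant_divide_insert:
  assumes "a \<in> U" "orient p b a \<noteq> 0"
  shows "card {S \<in> divide (insert a R) p b. U \<inter> S = {}} \<le> 1"
proof -
  have "\<exists>S\<in>divide (insert a R) p b. U \<inter> S \<noteq> {}"
    using assms by (cases "orient p b a > 0") (auto simp: divide_def)
  then have "{S \<in> divide (insert a R) p b. U \<inter> S = {}} \<subset> divide (insert a R) p b" by blast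
  then have "card {S \<in> divide (insert a R) p b. U \<inter> S = {}} < card (divide (insert a R) p b)"
    by (intro psubset_card_mono finite_divide)
  with card_divide[of "insert a R" p b] show ?thesis by linarith
qed

lemma finite_vacant: "finite (snd (snd S)) \<Longrightarrow> finite (vacant S e)"
  unfolding vacant_def
  by (rule finite_subset[of _ "fst ` snd (snd S)"]) force+

section \<open>Accounts of the whole matching\<close>

text \<open>Edges are unordered sets, so \<open>Min\<close> and \<open>Max\<close> supply the
  lighter and the heavier weight without choosing an order of the endpoints.\<close>

definition balanced :: "real \<Rightarrow> real \<Rightarrow> (point \<Rightarrow> real) \<Rightarrow> point list \<Rightarrow> bim_state \<Rightarrow> bool" where
  "balanced r c w ps S \<longleftrightarrow> (\<exists>A.
     (\<forall>e\<in>fst S. secured r c (Min (w ` e)) (Max (w ` e)) (card (vacant S e)) (A e)) \<and>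
     (\<Sum>e\<in>fst S. A e) \<le> profit w (fst S) - c * OPT w ps)"

lemma balanced_start:
  assumes "p \<noteq> q" "0 \<le> c" "0 \<le> r" "0 \<le> w p" "0 \<le> w q"
  shows "balanced r c w [p, q] ({{p, q}}, {}, divide UNIV p q \<times> {{p, q}})"
    (is "balanced r c w _ ?S")
proof -
  have "vacant ?S {p, q} = divide UNIV p q" by (auto simp: vacant_def)
  then have "card (vacant ?S {p, q}) \<le> 2" using card_divide by simp
  moreover have "Min (w ` {p, q}) + Max (w ` {p, q}) = w p + w q" by (simp add: min_def max_def)
  \<comment> \<open>Both points arrive uncharged, so the first account is charged for each of
    them.\<close>
  ultimately have "secured r c (Min (w ` {p, q})) (Max (w ` {p, q})) (card (vacant ?S {p, q}))
      ((1 - c) * (w p + w q))"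
    using assms by (intro secured_fresh) auto
  moreover have "(1 - c) * (w p + w q) = profit w {{p, q}} - c * OPT w [p, q]"
    using assms(1) by (simp add: profit_def OPT_def algebra_simps)
  ultimately show ?thesis
    unfolding balanced_def by (intro exI[of _ "\<lambda>_. (1 - c) * (w p + w q)"]) simp
qed

lemma bim_wf_start:
  assumes "p \<noteq> q"
  shows "bim_wf [p, q] ({{p, q}}, {}, divide UNIV p q \<times> {{p, q}})"
  using assms by (intro bim_wfI) (auto simp: finite_divide dest: divideD divide_disjoint)

lemma Union_revoke:
  assumes "disjoint M" "{a, b} \<in> M"
  shows "\<Union>(M - {{a, b}}) = \<Union>M - {a, b}"
proof -
  have "e \<inter> {a, b} = {}" if "e \<in> M" "e \<noteq> {a, b}" for e
    using assms that by (auto dest: pairwiseD simp: disjnt_def)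
  then show ?thesis using assms(2) by blast
qed

lemma bim_wf_step:
  assumes wf: "bim_wf ps S" and p: "p \<notin> set ps" and step: "bim_step r w p S S'"
  shows "bim_wf (ps @ [p]) S'"
  using step
proof cases
  case (match R e D q U M)
  note wf = bim_wfD[OF wf[unfolded match(1)]]
  have q: "p \<noteq> q" "q \<in> set ps" "q \<notin> \<Union>M" and p': "p \<notin> \<Union>M" "p \<notin> U"
    using match wf(1-3) p by blast+
  have out: "x \<notin> T" if "(T, f) \<in> D" "(T, f) \<noteq> (R, e)" "x \<in> R" for T f x
    using that wf(10)[OF that(1) match(3)] by blast
  show ?thesis
    unfolding match(2)
  proof (intro bim_wfI)
    show "disjoint (insert {p, q} M)"
      using wf(4) q p' by (auto simp: pairwise_insert disjnt_def)
    fix T f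
    assume "(T, f) \<in> (D - {(R, e)}) \<union> divide R p q \<times> {{p, q}}"
    then consider "(T, f) \<in> D" "(T, f) \<noteq> (R, e)" | "T \<in> divide R p q" "f = {p, q}" by blast
    note T = this
    show "f \<in> insert {p, q} M" using T wf(8) by cases auto
    show "T \<inter> \<Union>(insert {p, q} M) = {}"
      using T
    proof cases
      case 1
      then show ?thesis using wf(9)[OF 1(1)] out[OF 1] match(4,5) by blast
    next
      case 2
      then show ?thesis using divideD[OF 2(1)] wf(9)[OF match(3)] by blast
    qed
    fix T' f' x
    assume "(T', f') \<in> (D - {(R, e)}) \<union> divide R p q \<times> {{p, q}}" and x: "x \<in> T" "x \<in> T'"
    then consider "(T', f') \<in> D" "(T', f') \<noteq> (R, e)" | "T' \<in> divide R p q" "f' = {p, q}" by blast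
    note T' = this
    show "T = T' \<and> f = f'"
      using T
    proof cases
      case 1
      note T1 = this
      show ?thesis
        using T'
      proof cases
        case 1
        with T1(1) x show ?thesis using wf(10) by metis
      next
        case 2
        with out[OF T1] x divideD(1) show ?thesis by blast
      qed
    next
      case 2
      note T2 = this
      show ?thesis
        using T'
      proof cases
        case 1
        with out[OF 1] x T2 divideD(1) show ?thesis by blast
      next
        case 2
        with T2 x divide_disjoint show ?thesis by simp
      qed
    qed
  qed (use wf(1-3,6) wf(5) q p' match in \<open>auto simp: finite_divide\<close>)
next
  case (skip R a b D U M)
  note wf = bim_wfD[OF wf[unfolded skip(1)]]
  show ?thesis
    unfolding skip(2) using wf p by (intro bim_wfI) (auto 4 3)
next
  case (improve R a b D U M)
  note wf = bim_wfD[OF wf[unfolded improve(1)]]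
  have ab: "{a, b} \<in> M" "a \<noteq> b" using wf(8)[OF improve(3)] wf(5) by fastforce+
  note rev = Union_revoke[OF wf(4) ab(1)]
  have p': "p \<notin> \<Union>M" "p \<notin> U" "p \<noteq> a" "p \<noteq> b" using wf(1,2) ab p by blast+
  let ?R = "insert a (\<Union>{S. (S, {a, b}) \<in> D})"
  \<comment> \<open>For \<open>x = a\<close> this holds because \<open>a\<close> is matched and thus
    lies in no region; the other points of \<open>?R\<close> lie in regions of
    \<open>{a, b}\<close>, disjoint from those of \<open>f\<close>.\<close>
  have out: "x \<notin> T" if "(T, f) \<in> D" "f \<noteq> {a, b}" "x \<in> ?R" for T f x
    using that wf(9)[OF that(1)] wf(10)[OF that(1)] ab by blast
  show ?thesis
    unfolding improve(2)
  proof (intro bim_wfI)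
    show "disjoint (insert {p, b} (M - {{a, b}}))"
      using wf(4) rev p' by (auto simp: pairwise_insert disjnt_def pairwise_subset)
    show "\<Union>(insert {p, b} (M - {{a, b}})) \<subseteq> set (ps @ [p])"
      using rev wf(1) ab by auto
    show "\<Union>(insert {p, b} (M - {{a, b}})) \<inter> insert a U = {}"
      using rev wf(3) ab p' by auto
    have "finite {(S, f) \<in> D. f \<noteq> {a, b}}" using wf(6) by (rule rev_finite_subset) auto
    then show "finite ({(S, f) \<in> D. f \<noteq> {a, b}} \<union> divide ?R p b \<times> {{p, b}})"
      by (simp add: finite_divide)
    fix T f
    assume "(T, f) \<in> {(S, f) \<in> D. f \<noteq> {a, b}} \<union> divide ?R p b \<times> {{p, b}}"
    then consider "(T, f) \<in> D" "f \<noteq> {a, b}" | "T \<in> divide ?R p b" "f = {p, b}" by blast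
    note T = this
    show "f \<in> insert {p, b} (M - {{a, b}})" using T wf(8) by cases auto
    show "T \<inter> \<Union>(insert {p, b} (M - {{a, b}})) = {}"
      using T
    proof cases
      case 1
      have "p \<in> ?R" using improve(3,4) by blast
      then show ?thesis using wf(9)[OF 1(1)] out[OF 1] ab by blast
    next
      case 2
      \<comment> \<open>The only matched point in the merged region is \<open>a\<close>, which is
        just being freed.\<close>
      have "?R \<inter> \<Union>M \<subseteq> {a}" using wf(9) by blast
      then show ?thesis using divideD[OF 2(1)] rev by blast
    qed
    fix T' f' x
    assume "(T', f') \<in> {(S, f) \<in> D. f \<noteq> {a, b}} \<union> divide ?R p b \<times> {{p, b}}"
      and x: "x \<in> T" "x \<in> T'"
    then consider "(T', f') \<in> D" "f' \<noteq> {a, b}" | "T' \<in> divide ?R p b" "f' = {p, b}" by blast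
    note T' = this
    show "T = T' \<and> f = f'"
      using T
    proof cases
      case 1
      note T1 = this
      show ?thesis
        using T'
      proof cases
        case 1
        with T1(1) x show ?thesis using wf(10) by metis
      next
        case 2
        with out[OF T1] x divideD(1) show ?thesis by blast
      qed
    next
      case 2
      note T2 = this
      show ?thesis
        using T'
      proof cases
        case 1
        with out[OF 1] x T2 divideD(1) show ?thesis by blast
      next
        case 2
        with T2 x divide_disjoint show ?thesis by simp
      qed
    qed
  qed (use wf(1,2,5) ab p' in auto)
qed

lemma OPT_snoc: "OPT w (ps @ [p]) = OPT w ps + w p"
  by (simp add: OPT_def)

text \<open>Has \<open>secured_mono\<close> built in: an untouched account stays valid as soon as
  its edge gains no vacant regions.\<close>

lemma balancedE:
  assumes "balanced r c w ps S"
    and "bim_wf ps S" "0 \<le> c" "0 \<le> r" "\<forall>p\<in>set ps. 0 \<le> w p"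
  obtains A where
    "\<And>e m. e \<in> fst S \<Longrightarrow> m \<le> card (vacant S e) \<Longrightarrow>
       secured r c (Min (w ` e)) (Max (w ` e)) m (A e)"
    "sum A (fst S) \<le> profit w (fst S) - c * OPT w ps"
proof -
  obtain M U D where S: "S = (M, U, D)" by (cases S)
  note wf = bim_wfD[OF assms(2)[unfolded S]]
  obtain A where A: "\<forall>e\<in>fst S. secured r c (Min (w ` e)) (Max (w ` e)) (card (vacant S e)) (A e)"
    "sum A (fst S) \<le> profit w (fst S) - c * OPT w ps"
    using assms(1) by (auto simp: balanced_def)
  show thesis
  proof (rule that[OF _ A(2)])
    fix e m assume e: "e \<in> fst S" "m \<le> card (vacant S e)"
    then have "e \<in> M" by (simp add: S)
    then obtain a b where "e = {a, b}" "a \<in> set ps" "b \<in> set ps"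
      using wf(1) wf(5)[of e] by (auto simp: card_2_iff)
    then have "0 \<le> Max (w ` e)" using assms(5) by (simp add: max_def)
    then show "secured r c (Min (w ` e)) (Max (w ` e)) m (A e)"
      using A(1) e assms(3,4) secured_mono by blast
  qed
qed

lemma balanced_step:
  assumes bal: "balanced r c w ps S" and wf: "bim_wf ps S" and p: "p \<notin> set ps"
    and gp: "\<forall>a\<in>set ps. \<forall>b\<in>set ps. a \<noteq> b \<longrightarrow> \<not> collinear {a, b, p}"
    and c: "0 \<le> c" and r: "1 < r" "r \<le> sqrt 2"
    and w: "\<forall>p\<in>set ps. 0 \<le> w p" "0 \<le> w p"
    and step: "bim_step r w p S S'"
  shows "balanced r c w (ps @ [p]) S'"
proof -
  have r0: "0 \<le> r" using r by simp
  obtain A where A: "\<And>e m. e \<in> fst S \<Longrightarrow> m \<le> card (vacant S e) \<Longrightarrow>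
       secured r c (Min (w ` e)) (Max (w ` e)) m (A e)"
    "sum A (fst S) \<le> profit w (fst S) - c * OPT w ps"
    using balancedE[OF bal wf c r0 w(1)] by blast
  show ?thesis
    using step
  proof cases
    case (match R e D q U M)
    note wf = bim_wfD[OF wf[unfolded match(1)]]
    have M: "fst S = M" by (simp add: match(1))
    note A = A[unfolded M]
    have q: "p \<noteq> q" "q \<in> set ps" "q \<notin> \<Union>M" and p': "p \<notin> \<Union>M" "p \<notin> U"
      using match wf(1-3) p by blast+
    then have new: "{p, q} \<notin> M" by blast
    have fin: "finite (\<Union>M)" using wf(1) finite_subset by blast
    define A' where "A' = A({p, q} := (1 - c) * w p + w q)"
    have "secured r c (Min (w ` f)) (Max (w ` f)) (card (vacant S' f)) (A' f)"
      if f: "f \<in> insert {p, q} M" for f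
    proof (cases "f = {p, q}")
      case True
      have "vacant S' f \<subseteq> divide R p q"
        using True new wf(8) unfolding vacant_def match(2) by auto
      then have "card (vacant S' f) \<le> card (divide R p q)" by (intro card_mono finite_divide)
      then have "card (vacant S' f) \<le> 2" using card_divide[of R p q] by linarith
      then show ?thesis
        unfolding True A'_def using c r w q by (simp only: fun_upd_same) (intro secured_match; simp)
    next
      case False
      \<comment> \<open>Matching \<open>q\<close> could vacate a region, but by disjointness
        \<open>q\<close> lies only in \<open>R\<close>, which has just been divided.\<close>
      have "vacant S' f \<subseteq> vacant S f"
      proof
        fix T assume "T \<in> vacant S' f"
        then have T: "(T, f) \<in> D" "(T, f) \<noteq> (R, e)" "(U - {q}) \<inter> T = {}"
          using False unfolding vacant_def match(2) by auto
        then have "q \<notin> T" using wf(10)[OF T(1) match(3)] match(5) by blast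
        with T show "T \<in> vacant S f" unfolding vacant_def match(1) by auto
      qed
      then have "card (vacant S' f) \<le> card (vacant S f)"
        using finite_vacant[of S f] wf(6) match(1) by (intro card_mono) auto
      then show ?thesis using A(1) f False by (simp add: A'_def)
    qed
    moreover have "sum A' (insert {p, q} M) = sum A M + (1 - c) * w p + w q"
      using new wf(7) by (auto simp: A'_def intro: sum.cong)
    moreover have "profit w (insert {p, q} M) = profit w M + w p + w q"
      using q p' fin by (simp add: profit_def)
    ultimately show ?thesis
      using A(2) unfolding balanced_def
      by (intro exI[of _ A']) (simp add: match(2) OPT_snoc algebra_simps)
  next
    case (skip R a b D U M)
    note wf = bim_wfD[OF wf[unfolded skip(1)]]
    have M: "fst S = M" by (simp add: skip(1))
    note A = A[unfolded M]
    have ab: "{a, b} \<in> M" "b \<in> set ps" using wf(8)[OF skip(3)] wf(1) by auto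
    have fin: "finite (vacant S f)" for f using finite_vacant[of S f] wf(6) skip(1) by simp
    have sub: "vacant S' f \<subseteq> vacant S f" for f
      unfolding vacant_def skip(1,2) by auto
    define A' where "A' = A({a, b} := A {a, b} - c * w p)"
    have "secured r c (Min (w ` f)) (Max (w ` f)) (card (vacant S' f)) (A' f)" if f: "f \<in> M" for f
    proof (cases "f = {a, b}")
      case True
      \<comment> \<open>The skipped point occupies \<open>R\<close>, so the number of vacant regions
        drops strictly, as \<open>secured_skip\<close> requires.\<close>
      have "R \<in> vacant S f" "R \<notin> vacant S' f"
        using skip(3-5) True unfolding vacant_def skip(1,2) by auto
      then have "card (vacant S' f) < card (vacant S f)"
        using sub fin by (intro psubset_card_mono) auto
      then show ?thesis
        using A(1)[OF f order_refl] w ab c r skip(6,7) unfolding A'_def True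
        by (simp only: fun_upd_same) (rule secured_skip, auto simp: max_absorb2)
    next
      case False
      then show ?thesis using A(1)[OF f] sub fin by (simp add: A'_def card_mono)
    qed
    moreover have "sum A' M = sum A M - c * w p"
      using sum.remove[OF wf(7) ab(1), of A] sum.remove[OF wf(7) ab(1), of A']
      by (simp add: A'_def)
    ultimately show ?thesis
      using A(2) unfolding balanced_def
      by (intro exI[of _ A']) (simp add: skip(2) OPT_snoc algebra_simps)
  next
    case (improve R a b D U M)
    note wf = bim_wfD[OF wf[unfolded improve(1)]]
    have M: "fst S = M" by (simp add: improve(1))
    note A = A[unfolded M]
    have ab: "{a, b} \<in> M" "a \<noteq> b" using wf(8)[OF improve(3)] wf(5) by fastforce+
    have abs: "a \<in> set ps" "b \<in> set ps" using wf(1) ab by auto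
    note rev = Union_revoke[OF wf(4) ab(1)]
    have p': "p \<notin> \<Union>M" "p \<notin> U" "p \<noteq> a" "p \<noteq> b" using wf(1,2) ab p by blast+
    then have new: "{p, b} \<notin> M" by blast
    have fin: "finite (vacant S f)" for f using finite_vacant[of S f] wf(6) improve(1) by simp
    have finM: "finite (\<Union>M)" using wf(1) finite_subset by blast
    let ?R = "\<Union>{S. (S, {a, b}) \<in> D}"
    \<comment> \<open>As \<open>1 < r\<close>, the new point is the heavier end of the new edge and
      \<open>b\<close> the lighter one.\<close>
    have wb: "w b \<le> w p"
      using improve(7) r w abs mult_right_mono[of 1 r "w b"] by force
    define A' where "A' = A({p, b} := A {a, b} + (1 - c) * w p - w a)"
    have "secured r c (Min (w ` f)) (Max (w ` f)) (card (vacant S' f)) (A' f)"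
      if f: "f \<in> insert {p, b} (M - {{a, b}})" for f
    proof (cases "f = {p, b}")
      case True
      have "vacant S' f = {S \<in> divide (insert a ?R) p b. insert a U \<inter> S = {}}"
        using True new wf(8) unfolding vacant_def improve(2) by auto
      \<comment> \<open>General position keeps \<open>a\<close> off the line through
        \<open>p\<close> and \<open>b\<close>.\<close>
      moreover have "orient p b a \<noteq> 0"
        using orient_eq_0_imp_collinear[of p b a] gp abs ab(2) p' by (auto simp: insert_commute)
      ultimately have m': "card (vacant S' f) \<le> 1"
        using vacant_divide_insert[of a "insert a U" p b ?R] by (metis insertI1)
      have "R \<in> vacant S {a, b}" using improve(3,5) unfolding vacant_def improve(1) by auto
      then have m: "1 \<le> card (vacant S {a, b})" using fin by (auto simp: Suc_le_eq card_gt_0_iff)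
      have "secured r c (w a) (w b) (card (vacant S {a, b})) (A {a, b})"
        using A(1)[OF ab(1) order_refl] improve(6) by (simp add: min_absorb1 max_absorb2)
      then have "secured r c (w b) (w p) (card (vacant S' f)) (A {a, b} + (1 - c) * w p - w a)"
        using r c m m' w abs improve(6,7) by (intro secured_improve) auto
      then show ?thesis using wb by (simp add: True A'_def min_absorb2 max_absorb1)
    next
      case False
      \<comment> \<open>The set of unmatched points only grows here, so no old region becomes
        vacant.\<close>
      have "vacant S' f \<subseteq> vacant S f"
        using False f unfolding vacant_def improve(1,2) by auto
      then have "card (vacant S' f) \<le> card (vacant S f)" using fin by (intro card_mono) auto
      then show ?thesis using A(1) f False by (simp add: A'_def)
    qed
    moreover have "sum A' (insert {p, b} (M - {{a, b}})) = sum A M + (1 - c) * w p - w a"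
    proof -
      have "sum A' (M - {{a, b}}) = sum A (M - {{a, b}})"
        using new by (intro sum.cong) (auto simp: A'_def)
      then show ?thesis
        using sum.remove[OF wf(7) ab(1), of A] new wf(7) by (simp add: A'_def)
    qed
    moreover have "profit w (insert {p, b} (M - {{a, b}})) = profit w M + w p - w a"
    proof -
      have "\<Union>(insert {p, b} (M - {{a, b}})) = insert p (\<Union>M - {a})"
        using rev ab by auto
      moreover have "a \<in> \<Union>M" using ab by blast
      ultimately show ?thesis
        using p' finM by (simp add: profit_def sum_diff1)
    qed
    ultimately show ?thesis
      using A(2) unfolding balanced_def
      by (intro exI[of _ A']) (simp add: improve(2) OPT_snoc algebra_simps)
  qed
qed

lemma bim_run_balanced:
  assumes "bim_run r w ps S" "general_position ps" "\<forall>p\<in>set ps. 0 \<le> w p"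
    and "1 < r" "r \<le> sqrt 2" "0 \<le> c"
  shows "bim_wf ps S \<and> balanced r c w ps S"
  using assms(1-3)
proof induction
  case (start p q)
  then have "p \<noteq> q" by (simp add: general_position_def)
  with start show ?case using assms(4-6) by (simp add: bim_wf_start balanced_start)
next
  case (arrive ps S p S')
  have gp: "general_position ps" "p \<notin> set ps"
    using arrive.prems(1) by (auto simp: general_position_def)
  moreover have "\<forall>a\<in>set ps. \<forall>b\<in>set ps. a \<noteq> b \<longrightarrow> \<not> collinear {a, b, p}"
    using arrive.prems(1) gp(2) unfolding general_position_def by auto
  ultimately show ?case
    using arrive assms(4-6) bim_wf_step[of ps S p r w S'] balanced_step[of r c w ps S p S'] by simp
qed

theorem theorem12:
  fixes r :: real and n :: nat and ps :: "point list" and w :: "point \<Rightarrow> real" and M :: "edge set"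
  assumes "1 < r" and "r \<le> sqrt 2"
    and "n \<ge> 1" and "length ps = 2 * n" and "general_position ps"
    and "\<forall>p\<in>set ps. w p > 0"
    and "bim_result r w ps M"
  shows "profit w M \<ge> min ((r\<^sup>2 - 1) / r ^ 3) (1 / (1 + 2 * r)) * OPT w ps"
proof -
  define c where "c = min ((r\<^sup>2 - 1) / r ^ 3) (1 / (1 + 2 * r))"
  have "1 < r\<^sup>2" using assms(1) by (simp add: one_less_power)
  then have c0: "0 \<le> c" using assms(1) by (simp add: c_def)
  \<comment> \<open>The two terms of the minimum yield the two conditions on \<open>c\<close> in
    \<open>secured_nonneg\<close>.\<close>
  have "c \<le> 1 / (1 + 2 * r)" "c \<le> (r\<^sup>2 - 1) / r ^ 3" by (simp_all add: c_def)
  then have c1: "c * (1 + 2 * r) \<le> 1" and c2: "c * r ^ 3 \<le> r\<^sup>2 - 1"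
    using assms(1) by (simp_all add: pos_le_divide_eq)
  obtain U D where run: "bim_run r w ps (M, U, D)" using assms(7) by (auto simp: bim_result_def)
  have w: "\<forall>p\<in>set ps. 0 \<le> w p" using assms(6) by (simp add: less_imp_le)
  have wf: "bim_wf ps (M, U, D)" and bal: "balanced r c w ps (M, U, D)"
    using bim_run_balanced[OF run assms(5) w assms(1,2) c0] by auto
  obtain A where A:
    "\<And>e. e \<in> M \<Longrightarrow> secured r c (Min (w ` e)) (Max (w ` e)) (card (vacant (M, U, D) e)) (A e)"
    "sum A M \<le> profit w M - c * OPT w ps"
    using bal by (auto simp: balanced_def)
  have "0 \<le> A e" if e: "e \<in> M" for e
  proof -
    obtain a b where "e = {a, b}" using bim_wfD(5)[OF wf e] by (auto simp: card_2_iff)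
    moreover from this have "0 \<le> w a" "0 \<le> w b" using w bim_wfD(1)[OF wf] e by auto
    ultimately have "0 \<le> Min (w ` e)" "0 \<le> Max (w ` e)" by auto
    then show ?thesis using secured_nonneg[OF A(1)[OF e] assms(1) c0 c1 c2] by blast
  qed
  then have "0 \<le> sum A M" by (rule sum_nonneg)
  with A(2) show ?thesis unfolding c_def by linarith
qed

end
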